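(* Suppose that $M=(m_t)$ is an increasing sequence of positive integers and $Q_1=(q_{1,n}), Q_2=(q_{2,n}),\ldots,Q_j=(q_{j,n})$ are basic sequences that are infinite in limit. Set $$\Psi_j(x)=\left(\psi_{Q_{j-1},Q_j}\circ\psi_{Q_{j-2},Q_{j-1}}\circ\cdots\circ\psi_{Q_1,Q_2}\right)(x).$$ If $x=E_0.E_1E_2\cdots$ w.r.t. $Q_1$ satisfies $E_n<\min_{2\le r\le j}(q_{r,n}-1)$ for infinitely many $n$, then $\Psi_j(x)\in\mathscr{U}_{Q_j}$ and for every block $B$ $$N_{M,n}^{Q_j}\left(B,\Psi_j(x)\right)=N_{M,n}^{Q_1}(B,x)+O(1).$$
   Context: A basic sequence is a sequence $Q=(q_n)_{n\ge1}$ of integers $q_n\ge 2$; it is infinite in limit if $q_n\to\infty$. The $Q$-Cantor series expansion of $x\in\mathbb{R}$, abbreviated $x=E_0.E_1E_2\cdots$ w.r.t. $Q$, is the unique expansion $x=E_0+\sum_{n\ge1}\frac{E_n}{q_1\cdots q_n}$ with $E_0=\lfloor x\rfloor$, $E_n\in\{0,1,\ldots,q_n-1\}$ for $n\ge 1$, and $E_n\ne q_n-1$ for infinitely many $n$. For basic sequences $P=(p_n),Q=(q_n)$ and $x=E_0.E_1E_2\cdots$ w.r.t. $P$, define $\psi_{P,Q}(x)=\sum_{n=1}^\infty\frac{\min(E_n,q_n-1)}{q_1\cdots q_n}$. For a basic sequence $Q$, $\mathscr{U}_Q=\{x=E_0.E_1E_2\cdots\text{ w.r.t. }Q: E_n\ne0\text{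 infinitely often}\}$. A block is a finite ordered tuple of non-negative integers. $N_{M,n}^Q(B,x)$ is the number of occurrences of the block $B$ at positions $m_t$ with $m_t\le n$ in the $Q$-Cantor series expansion of the fractional part $\{x\}$. The $O(1)$ is as $n\to\infty$.
   Formalization: The claim that Ψ_j(x) lies in U_{Q_j} is stated only for x in U_{Q_1}; without this it fails, e.g. for x = 0, whose image 0 has only zero digits. The block-count estimate is proved without this condition. *)

theory Defs
  imports Complex_Main "HOL-Library.Landau_Symbols"
begin

text \<open>Sequences \<open>(q\<^sub>n)\<close> with \<open>n \<ge> 1\<close> are functions on \<open>nat\<close> whose value at \<open>0\<close> is never used.\<close>

definition basic_sequence :: "(nat \<Rightarrow> int) \<Rightarrow> bool" where
  "basic_sequence q \<longleftrightarrow> (\<forall>n\<ge>1. q n \<ge> 2)"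

definition infinite_in_limit :: "(nat \<Rightarrow> int) \<Rightarrow> bool" where
  "infinite_in_limit q \<longleftrightarrow> filterlim q at_top sequentially"

text \<open>\<open>cantor_expansion q x E\<close> says \<open>x = E\<^sub>0.E\<^sub>1E\<^sub>2\<dots>\<close> w.r.t. \<open>q\<close>. The integer part is stored as
  \<open>E 0\<close>, so that \<open>E\<close> is determined by \<open>q\<close> and \<open>x\<close>. The summand with index \<open>n\<close> of the series
  below is the one belonging to the digit \<open>E (Suc n)\<close>.\<close>

definition cantor_expansion :: "(nat \<Rightarrow> int) \<Rightarrow> real \<Rightarrow> (nat \<Rightarrow> int) \<Rightarrow> bool" where
  "cantor_expansion q x E \<longleftrightarrow>
     E 0 = \<lfloor>x\<rfloor> \<and>
     (\<forall>n\<ge>1. E n \<in> {0..q n - 1}) \<and>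
     (\<exists>\<^sub>\<infinity>n. E n \<noteq> q n - 1) \<and>
     (\<lambda>n. of_int (E (Suc n)) / of_int (\<Prod>k=1..Suc n. q k)) sums (x - of_int (E 0))"

definition cantor_digit :: "(nat \<Rightarrow> int) \<Rightarrow> real \<Rightarrow> nat \<Rightarrow> int" where
  "cantor_digit q x = (THE E. cantor_expansion q x E)"

definition psi :: "(nat \<Rightarrow> int) \<Rightarrow> (nat \<Rightarrow> int) \<Rightarrow> real \<Rightarrow> real" where
  "psi p q x =
     (\<Sum>n. of_int (min (cantor_digit p x (Suc n)) (q (Suc n) - 1)) / of_int (\<Prod>k=1..Suc n. q k))"

text \<open>\<open>Psi Q j\<close> is the composition of \<open>psi (Q (j - 1)) (Q j)\<close>, \dots, \<open>psi (Q 1) (Q 2)\<close>; the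
  sequences \<open>Q r\<close> are numbered from \<open>r = 1\<close> and the composition is empty for \<open>j \<le> 1\<close>.\<close>

fun Psi :: "(nat \<Rightarrow> nat \<Rightarrow> int) \<Rightarrow> nat \<Rightarrow> real \<Rightarrow> real" where
  "Psi Q 0 = id"
| "Psi Q (Suc 0) = id"
| "Psi Q (Suc (Suc j)) = psi (Q (Suc j)) (Q (Suc (Suc j))) \<circ> Psi Q (Suc j)"

definition U_set :: "(nat \<Rightarrow> int) \<Rightarrow> real set" where
  "U_set q = {x. \<exists>E. cantor_expansion q x E \<and> (\<exists>\<^sub>\<infinity>n. E n \<noteq> 0)}"

text \<open>An occurrence of \<open>B\<close> is located by the position of its first digit, and only that
  position is required to be at most \<open>n\<close>.\<close>

definition block_count :: "(nat \<Rightarrow> nat) \<Rightarrow> (nat \<Rightarrow> int) \<Rightarrow> nat \<Rightarrow> nat list \<Rightarrow> real \<Rightarrow> nat" where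
  "block_count M q n B x =
     card {t. t \<ge> 1 \<and> M t \<le> n \<and>
              (\<forall>i<length B. cantor_digit q (frac x) (M t + i) = int (B ! i))}"

end

(* The digits of Psi_j(x) are the digits E_n of x clipped at q_{r,n} - 1 for r = 2, ..., j.  The
   smallness hypothesis keeps infinitely many digits below the maximal value at every stage, so the
   clipped digits are legitimate Cantor series digits.  Since every q_{r,n} tends to infinity, clipping
   does not affect the equations E_n = b with b bounded, except for finitely many n. *)

theory Submission imports Defs "HOL-Library.Infinite_Set" begin

section \<open>Cantor series\<close>

lemma prod_ge_power2:
  fixes q :: "nat \<Rightarrow> int"
  assumes "basic_sequence q"
  shows "(2::int) ^ n \<le> (\<Prod>k=1..n. q k)"
proof -
  have "(\<Prod>k=1..n. (2::int)) \<le> (\<Prod>k=1..n. q k)"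
    using assms by (intro prod_mono) (auto simp: basic_sequence_def)
  then show ?thesis by simp
qed

lemma prod_basic_pos:
  assumes "basic_sequence q"
  shows "(\<Prod>k=1..n. q k) > 0"
  using less_le_trans[OF _ prod_ge_power2[OF assms]] by simp

lemma prod_basic_pos_real:
  assumes "basic_sequence q"
  shows "real_of_int (\<Prod>k=1..n. q k) > 0"
  using prod_basic_pos[OF assms] by (simp only: of_int_0_less_iff)

lemma inverse_prod_tendsto_0:
  assumes "basic_sequence q"
  shows "(\<lambda>n. 1 / real_of_int (\<Prod>k=1..n. q k)) \<longlonglongrightarrow> 0"
proof (rule tendsto_sandwich)
  show "\<forall>\<^sub>F n in sequentially. 0 \<le> 1 / real_of_int (\<Prod>k=1..n. q k)"
    using prod_basic_pos_real[OF assms]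
    by (intro always_eventually allI) (simp add: less_imp_le del: of_int_prod)
  have "1 / real_of_int (\<Prod>k=1..n. q k) \<le> (1/2) ^ n" for n
  proof -
    have "real_of_int (2 ^ n) \<le> real_of_int (\<Prod>k=1..n. q k)"
      using prod_ge_power2[OF assms] by (simp only: of_int_le_iff)
    then have "1 / real_of_int (\<Prod>k=1..n. q k) \<le> 1 / real_of_int (2 ^ n)"
      by (intro divide_left_mono mult_pos_pos) (auto intro: less_le_trans[of 0 "2 ^ n"])
    then show ?thesis by (simp add: power_one_over)
  qed
  then show "\<forall>\<^sub>F n in sequentially. 1 / real_of_int (\<Prod>k=1..n. q k) \<le> (1/2) ^ n"
    by simp
  show "(\<lambda>n. (1/2::real) ^ n) \<longlonglongrightarrow> 0" by (rule LIMSEQ_power_zero) simp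
qed simp

text \<open>The term (q_n - 1)/(q_1 ... q_n) equals 1/(q_1 ... q_(n-1)) - 1/(q_1 ... q_n), so the
  series telescopes. This is the Cantor series form of 0.999... = 1.\<close>

lemma max_digits_sums:
  assumes "basic_sequence q"
  shows "(\<lambda>n. real_of_int (q (Suc (n + k)) - 1) / of_int (\<Prod>i=1..Suc (n + k). q i))
           sums (1 / of_int (\<Prod>i=1..k. q i))"
proof -
  let ?f = "\<lambda>n. 1 / real_of_int (\<Prod>i=1..n + k. q i)"
  have "?f \<longlonglongrightarrow> 0"
    using inverse_prod_tendsto_0[OF assms] by (rule LIMSEQ_ignore_initial_segment)
  then have "(\<lambda>n. ?f n - ?f (Suc n)) sums (?f 0 - 0)"
    by (rule telescope_sums')
  moreover have "?f n - ?f (Suc n) =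
      real_of_int (q (Suc (n + k)) - 1) / of_int (\<Prod>i=1..Suc (n + k). q i)" for n
  proof -
    have "real_of_int (\<Prod>i=1..n + k. q i) > 0"
      by (rule prod_basic_pos_real[OF assms])
    moreover have "real_of_int (q (Suc (n + k))) > 0"
      using assms by (auto simp: basic_sequence_def intro: less_le_trans[of 0 2])
    ultimately show ?thesis
      by (simp add: divide_simps del: of_int_prod)
  qed
  ultimately show ?thesis by simp
qed

section \<open>Admissible digit sequences, their tails and uniqueness\<close>

definition cantor_digits :: "(nat \<Rightarrow> int) \<Rightarrow> (nat \<Rightarrow> int) \<Rightarrow> bool" where
  "cantor_digits q E \<longleftrightarrow> (\<forall>n\<ge>1. E n \<in> {0..q n - 1}) \<and> (\<exists>\<^sub>\<infinity>n. E n \<noteq> q n - 1)"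

text \<open>The tail is not rescaled: it is the error of truncating after k digits, so its natural
  unit is 1/(q_1 ... q_k). At k = 0 it is the fractional part.\<close>

definition cantor_tail :: "(nat \<Rightarrow> int) \<Rightarrow> (nat \<Rightarrow> int) \<Rightarrow> nat \<Rightarrow> real" where
  "cantor_tail q E k = (\<Sum>n. of_int (E (Suc (n + k))) / of_int (\<Prod>i=1..Suc (n + k). q i))"

lemma cantor_digits_summable:
  assumes "basic_sequence q" "cantor_digits q E"
  shows "summable (\<lambda>n. real_of_int (E (Suc (n + k))) / of_int (\<Prod>i=1..Suc (n + k). q i))"
proof (rule summable_comparison_test'[OF sums_summable[OF max_digits_sums[OF assms(1)]]])
  fix n
  have "real_of_int (\<Prod>i=1..Suc (n + k). q i) > 0"
    by (rule prod_basic_pos_real[OF assms(1)])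
  moreover have "0 \<le> E (Suc (n + k))" "E (Suc (n + k)) \<le> q (Suc (n + k)) - 1"
    using assms(2) by (auto simp: cantor_digits_def)
  ultimately show "norm (real_of_int (E (Suc (n + k))) / of_int (\<Prod>i=1..Suc (n + k). q i))
      \<le> real_of_int (q (Suc (n + k)) - 1) / of_int (\<Prod>i=1..Suc (n + k). q i)"
    by (simp add: divide_right_mono abs_of_pos del: of_int_prod of_int_diff prod.cl_ivl_Suc)
qed

text \<open>Termwise comparison with the maximal digits gives the upper bound; a later non-maximal
  digit makes it strict. Strictness is what yields uniqueness of digits and a vanishing
  floor.\<close>

lemma cantor_tail_bounds:
  assumes "basic_sequence q" "cantor_digits q E"
  shows "0 \<le> cantor_tail q E k" "cantor_tail q E k < 1 / of_int (\<Prod>i=1..k. q i)"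
proof -
  let ?P = "\<lambda>n. real_of_int (\<Prod>i=1..Suc (n + k). q i)"
  have P: "?P n > 0" for n
    by (rule prod_basic_pos_real[OF assms(1)])
  have E: "0 \<le> E (Suc (n + k))" "E (Suc (n + k)) \<le> q (Suc (n + k)) - 1" for n
    using assms(2) by (auto simp: cantor_digits_def)
  note sE = cantor_digits_summable[OF assms, of k]
  show "0 \<le> cantor_tail q E k"
    unfolding cantor_tail_def using P E
    by (intro suminf_nonneg sE) (simp add: less_imp_le del: of_int_prod prod.cl_ivl_Suc)
  let ?d = "\<lambda>n. real_of_int (q (Suc (n + k)) - 1) / ?P n - real_of_int (E (Suc (n + k))) / ?P n"
  have d: "?d sums (1 / of_int (\<Prod>i=1..k. q i) - cantor_tail q E k)"
    unfolding cantor_tail_def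
    by (rule sums_diff[OF max_digits_sums[OF assms(1)] summable_sums[OF sE]])
  have d': "?d n = (real_of_int (q (Suc (n + k)) - 1) - real_of_int (E (Suc (n + k)))) / ?P n" for n
    by (simp only: diff_divide_distrib)
  \<comment> \<open>Non-maximal digits occur beyond every position, so some term of the nonnegative
    series \<open>?d\<close> is positive.\<close>
  obtain m where m: "m > k" "E m \<noteq> q m - 1"
    using assms(2) unfolding cantor_digits_def INFM_nat by blast
  obtain l where l: "m = Suc (l + k)"
    using m(1) by (metis add.commute less_imp_Suc_add)
  have "real_of_int (E (Suc (l + k))) < real_of_int (q (Suc (l + k)) - 1)"
    using E(2)[of l] m(2) unfolding l of_int_less_iff by linarith
  then have "?d l > 0"
    unfolding d' by (intro divide_pos_pos P) linarith
  moreover have "?d n \<ge> 0" for n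
    unfolding d' using E(2)[of n] P[of n] by (intro divide_nonneg_pos) linarith+
  ultimately have "suminf ?d > 0"
    by (intro suminf_pos2[where i = l] sums_summable[OF d])
  then show "cantor_tail q E k < 1 / of_int (\<Prod>i=1..k. q i)"
    using sums_unique[OF d] by linarith
qed

lemma cantor_tail_Suc:
  assumes "basic_sequence q" "cantor_digits q E"
  shows "cantor_tail q E k =
    of_int (E (Suc k)) / of_int (\<Prod>i=1..Suc k. q i) + cantor_tail q E (Suc k)"
  using suminf_split_head[OF cantor_digits_summable[OF assms, of k]]
  unfolding cantor_tail_def by (simp del: prod.cl_ivl_Suc of_int_prod)

text \<open>Digits are peeled off one at a time: equal tails force equal leading digits, and
  cancelling these leaves equal tails again.\<close>

lemma cantor_digits_unique:
  assumes q: "basic_sequence q" and E: "cantor_digits q E" and F: "cantor_digits q F"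
    and eq: "cantor_tail q E 0 = cantor_tail q F 0"
  shows "E (Suc n) = F (Suc n)"
proof -
  have step: "E (Suc k) = F (Suc k)" "cantor_tail q E (Suc k) = cantor_tail q F (Suc k)"
    if "cantor_tail q E k = cantor_tail q F k" for k
  proof -
    let ?P = "real_of_int (\<Prod>i=1..Suc k. q i)"
    have P: "?P > 0"
      by (rule prod_basic_pos_real[OF q])
    have *: "of_int (E (Suc k)) / ?P + cantor_tail q E (Suc k) =
        of_int (F (Suc k)) / ?P + cantor_tail q F (Suc k)"
      using that cantor_tail_Suc[OF q E, of k] cantor_tail_Suc[OF q F, of k] by simp
    \<comment> \<open>Up to sign this is the difference of the two next tails, both in the half-open
      interval [0, 1/\<open>?P\<close>). Multiplied by \<open>?P\<close>, it bounds a difference of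
      integers by less than 1.\<close>
    have "\<bar>of_int (E (Suc k)) / ?P - of_int (F (Suc k)) / ?P\<bar> < 1 / ?P"
      using * cantor_tail_bounds[OF q E, of "Suc k"] cantor_tail_bounds[OF q F, of "Suc k"]
      by linarith
    then have "\<bar>real_of_int (E (Suc k)) - of_int (F (Suc k))\<bar> < 1"
      using P by (simp add: diff_divide_distrib[symmetric] abs_divide divide_less_cancel
          del: of_int_prod prod.cl_ivl_Suc)
    then show "E (Suc k) = F (Suc k)" by linarith
    then show "cantor_tail q E (Suc k) = cantor_tail q F (Suc k)" using * by simp
  qed
  have "cantor_tail q E n = cantor_tail q F n"
    by (induction n) (use eq step in auto)
  then show ?thesis by (rule step)
qed

lemma cantor_expansion_digits: "cantor_expansion q x E \<Longrightarrow> cantor_digits q E"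
  by (simp add: cantor_expansion_def cantor_digits_def)

lemma cantor_expansion_tail: "cantor_expansion q x E \<Longrightarrow> cantor_tail q E 0 = frac x"
  by (simp only: cantor_expansion_def cantor_tail_def frac_def add_0_right) (metis sums_unique)

lemma cantor_digit_eq:
  assumes q: "basic_sequence q" and E: "cantor_expansion q x E"
  shows "cantor_digit q x = E"
  unfolding cantor_digit_def
proof (rule the_equality)
  show "cantor_expansion q x E" by (rule E)
next
  fix F assume F: "cantor_expansion q x F"
  show "F = E"
  proof
    fix n
    show "F n = E n"
    proof (cases n)
      case 0
      then show ?thesis using E F by (simp add: cantor_expansion_def)
    next
      case (Suc m)
      show ?thesis unfolding Suc
        using E F cantor_expansion_digits cantor_expansion_tail
        by (intro cantor_digits_unique[OF q]) auto
    qed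
  qed
qed

section \<open>From admissible digit sequences to expansions of their sums\<close>

lemma cantor_digits_cong:
  assumes "cantor_digits q E" "\<And>n. n \<ge> 1 \<Longrightarrow> F n = E n"
  shows "cantor_digits q F"
proof -
  have "\<exists>\<^sub>\<infinity>n. E n \<noteq> q n - 1" using assms(1) by (simp add: cantor_digits_def)
  moreover have "\<forall>\<^sub>\<infinity>n. E n \<noteq> q n - 1 \<longrightarrow> F n \<noteq> q n - 1"
    unfolding MOST_nat_le using assms(2) by (intro exI[of _ 1]) auto
  ultimately have "\<exists>\<^sub>\<infinity>n. F n \<noteq> q n - 1" by (rule frequently_mp[rotated])
  then show ?thesis using assms by (auto simp: cantor_digits_def)
qed

text \<open>The sum lies in [0, 1), so its integer part is 0. Entry 0 of an admissible sequence is
  arbitrary and has to be reset to this value.\<close>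

lemma cantor_expansion_suminf:
  assumes q: "basic_sequence q" and E: "cantor_digits q E"
  shows "cantor_expansion q
    (\<Sum>n. of_int (E (Suc n)) / of_int (\<Prod>k=1..Suc n. q k)) (E(0 := 0))"
proof -
  let ?x = "\<Sum>n. real_of_int (E (Suc n)) / of_int (\<Prod>k=1..Suc n. q k)"
  have x: "?x = cantor_tail q E 0" by (simp add: cantor_tail_def)
  have "\<lfloor>?x\<rfloor> = 0"
    unfolding x floor_eq_iff using cantor_tail_bounds[OF q E, of 0] by simp
  moreover have "cantor_digits q (E(0 := 0))"
    using E by (rule cantor_digits_cong) simp
  moreover have "(\<lambda>n. real_of_int (E (Suc n)) / of_int (\<Prod>k=1..Suc n. q k)) sums ?x"
    using cantor_digits_summable[OF q E, of 0] by (simp only: add_0_right summable_sums)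
  ultimately show ?thesis
    unfolding cantor_expansion_def cantor_digits_def by (simp del: prod.cl_ivl_Suc)
qed

text \<open>Block counts read the digits of the fractional part; passing to it alters only entry
  0.\<close>

lemma cantor_digit_frac:
  assumes q: "basic_sequence q" and E: "cantor_expansion q x E" and "n \<ge> 1"
  shows "cantor_digit q (frac x) n = E n"
proof -
  have "cantor_expansion q (frac x) (E(0 := 0))"
    using cantor_expansion_suminf[OF q cantor_expansion_digits[OF E]]
      cantor_expansion_tail[OF E]
    by (simp add: cantor_tail_def del: prod.cl_ivl_Suc)
  then show ?thesis using cantor_digit_eq[OF q] \<open>n \<ge> 1\<close> by simp
qed

section \<open>Clipping digits\<close>

text \<open>Clipping could produce a forbidden tail of maximal digits; the positions where E is
  strictly below the clipping bound prevent this, so the series defining \<open>psi\<close> is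
  already a Cantor expansion.\<close>

lemma psi_expansion:
  assumes p: "basic_sequence p" and q: "basic_sequence q" and E: "cantor_expansion p x E"
    and small: "\<exists>\<^sub>\<infinity>n. E n < q n - 1"
  shows "cantor_expansion q (psi p q x) ((\<lambda>n. min (E n) (q n - 1))(0 := 0))"
proof -
  have "cantor_digits q (\<lambda>n. min (E n) (q n - 1))"
    unfolding cantor_digits_def
  proof (intro conjI allI impI)
    fix n :: nat assume n: "n \<ge> 1"
    have "E n \<ge> 0" using E n by (simp add: cantor_expansion_def)
    moreover have "q n \<ge> 2" using q n by (simp add: basic_sequence_def)
    ultimately show "min (E n) (q n - 1) \<in> {0..q n - 1}" by auto
  next
    show "\<exists>\<^sub>\<infinity>n. min (E n) (q n - 1) \<noteq> q n - 1"
      using small by (rule INFM_mono) auto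
  qed
  from cantor_expansion_suminf[OF q this] show ?thesis
    unfolding psi_def cantor_digit_eq[OF p E] .
qed

text \<open>Successive clippings compose to a single minimum. Inserting \<open>E n\<close> keeps the
  set nonempty at j = 1. Entry 0 is excluded because it holds the integer part, which every
  application of \<open>psi\<close> resets to 0.\<close>

lemma Psi_expansion:
  assumes "j \<ge> 1" and "\<forall>r\<in>{1..j}. basic_sequence (Q r)" and E: "cantor_expansion (Q 1) x E"
    and "\<exists>\<^sub>\<infinity>n. \<forall>r\<in>{2..j}. E n < Q r n - 1"
  shows "\<exists>F. cantor_expansion (Q j) (Psi Q j x) F \<and>
    (\<forall>n\<ge>1. F n = Min (insert (E n) ((\<lambda>r. Q r n - 1) ` {2..j})))"
  using assms(1,2,4)
proof (induction j rule: dec_induct)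
  case base
  then show ?case using E by auto
next
  case (step j)
  \<comment> \<open>The recursive equation of \<open>Psi\<close> only matches a double
    successor.\<close>
  then obtain i where i: "j = Suc i" by (cases j) auto
  have "\<exists>\<^sub>\<infinity>n. \<forall>r\<in>{2..j}. E n < Q r n - 1"
    using step.prems(2) by (rule INFM_mono) auto
  with step.IH step.prems(1) obtain F where F: "cantor_expansion (Q j) (Psi Q j x) F"
    "\<And>n. n \<ge> 1 \<Longrightarrow> F n = Min (insert (E n) ((\<lambda>r. Q r n - 1) ` {2..j}))"
    by auto
  \<comment> \<open>Clipping only lowers digits, so smallness of the original E carries over to the
    digits F of the current stage.\<close>
  have "\<forall>\<^sub>\<infinity>n. (\<forall>r\<in>{2..Suc j}. E n < Q r n - 1) \<longrightarrow> F n < Q (Suc j) n - 1"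
    unfolding MOST_nat_le
  proof (intro exI[of _ 1] allI impI)
    fix n :: nat assume n: "1 \<le> n" and *: "\<forall>r\<in>{2..Suc j}. E n < Q r n - 1"
    have "F n \<le> E n" using F(2)[OF n] by simp
    also have "E n < Q (Suc j) n - 1" using * step.hyps by simp
    finally show "F n < Q (Suc j) n - 1" .
  qed
  then have "\<exists>\<^sub>\<infinity>n. F n < Q (Suc j) n - 1"
    using step.prems(2) by (rule frequently_mp)
  then have "cantor_expansion (Q (Suc j)) (psi (Q j) (Q (Suc j)) (Psi Q j x))
      ((\<lambda>n. min (F n) (Q (Suc j) n - 1))(0 := 0))"
    using step.prems(1) step.hyps by (intro psi_expansion F(1)) auto
  moreover have "psi (Q j) (Q (Suc j)) (Psi Q j x) = Psi Q (Suc j) x" by (simp add: i)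
  moreover have "min (F n) (Q (Suc j) n - 1) =
      Min (insert (E n) ((\<lambda>r. Q r n - 1) ` {2..Suc j}))" if "n \<ge> 1" for n
  proof -
    let ?f = "\<lambda>r. Q r n - 1"
    have "insert (E n) (?f ` {2..Suc j}) = insert (?f (Suc j)) (insert (E n) (?f ` {2..j}))"
      using step.hyps by (auto simp: atLeastAtMostSuc_conv)
    then show ?thesis
      using F(2)[OF that] by (simp del: Min_insert add: Min_insert[of "insert _ _"] min.commute)
  qed
  ultimately show ?case by (intro exI conjI) auto
qed

lemma eventually_ge_all:
  assumes "finite R" "\<forall>r\<in>R. infinite_in_limit (Q r)"
  shows "\<forall>\<^sub>F n in sequentially. \<forall>r\<in>R. c \<le> Q r n"
  using assms by (intro eventually_ball_finite) (auto simp: infinite_in_limit_def filterlim_at_top)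

section \<open>Counting blocks\<close>

lemma finite_strict_mono_le:
  fixes M :: "nat \<Rightarrow> nat"
  assumes "strict_mono_on {1..} M"
  shows "finite {t. t \<ge> 1 \<and> M t \<le> n}"
proof (rule finite_imageD)
  show "finite (M ` {t. t \<ge> 1 \<and> M t \<le> n})"
    by (rule finite_subset[of _ "{..n}"]) auto
  show "inj_on M {t. t \<ge> 1 \<and> M t \<le> n}"
    by (rule inj_on_subset[OF strict_mono_on_imp_inj_on[OF assms]]) auto
qed

text \<open>Occurrences starting beyond N are common to both expansions, so only the finitely many
  starts up to N can differ. Agreement is asked only for values in B, since large digits may well be
  changed by clipping.\<close>

lemma block_count_diff_le:
  assumes M: "\<forall>t\<ge>1. M t \<ge> 1" "strict_mono_on {1..} M"
    and p: "basic_sequence p" "cantor_expansion p x E"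
    and q: "basic_sequence q" "cantor_expansion q y F"
    and agree: "\<And>m b. m \<ge> N \<Longrightarrow> b \<in> set B \<Longrightarrow> F m = int b \<longleftrightarrow> E m = int b"
  shows "\<bar>real (block_count M q n B y) - real (block_count M p n B x)\<bar>
    \<le> real (card {t. t \<ge> 1 \<and> M t \<le> N})"
proof -
  let ?S = "\<lambda>G. {t. t \<ge> 1 \<and> M t \<le> n \<and> (\<forall>i<length B. G (M t + i) = int (B ! i))}"
  let ?D = "{t. t \<ge> 1 \<and> M t \<le> N}"
  have fin: "finite (?S G)" for G :: "nat \<Rightarrow> int"
    by (rule finite_subset[OF _ finite_strict_mono_le[OF M(2), of n]]) auto
  have le: "card (?S G) \<le> card (?S H) + card ?D"
    if "?S G \<subseteq> ?S H \<union> ?D" for G H :: "nat \<Rightarrow> int"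
    using card_mono[OF _ that] card_Un_le[of "?S H" ?D] fin finite_strict_mono_le[OF M(2), of N]
    by (meson finite_UnI le_trans)
  \<comment> \<open>As \<open>M t\<close> is at least 1, the positions \<open>M t + i\<close> avoid
    entry 0, where x and its fractional part may differ.\<close>
  have cp: "block_count M p n B x = card (?S E)"
    unfolding block_count_def
    by (intro arg_cong[where f = card] Collect_cong conj_cong refl all_cong)
      (use M(1) in \<open>simp add: cantor_digit_frac[OF p] trans_le_add1\<close>)
  have cq: "block_count M q n B y = card (?S F)"
    unfolding block_count_def
    by (intro arg_cong[where f = card] Collect_cong conj_cong refl all_cong)
      (use M(1) in \<open>simp add: cantor_digit_frac[OF q] trans_le_add1\<close>)
  have "t \<in> ?S F \<longleftrightarrow> t \<in> ?S E" if "t \<notin> ?D" for t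
    using that agree by (auto simp: not_le)
  then have "?S F \<subseteq> ?S E \<union> ?D" "?S E \<subseteq> ?S F \<union> ?D" by blast+
  then have "card (?S F) \<le> card (?S E) + card ?D" "card (?S E) \<le> card (?S F) + card ?D"
    using le by blast+
  then show ?thesis unfolding cp cq by linarith
qed

text \<open>Membership in \<open>U_set (Q j)\<close> is stated as an implication because x = 0 meets
  the smallness condition while all its digits, and those of its image, are 0.\<close>

theorem theorem1p3:
  fixes M :: "nat \<Rightarrow> nat" and Q :: "nat \<Rightarrow> nat \<Rightarrow> int" and j :: nat
    and x :: real and E :: "nat \<Rightarrow> int"
  assumes M_pos: "\<forall>t\<ge>1. M t \<ge> 1"
    and M_incr: "strict_mono_on {1..} M"
    and j_ge: "j \<ge> 2"
    and Q_basic: "\<forall>r\<in>{1..j}. basic_sequence (Q r)"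
    and Q_inf: "\<forall>r\<in>{1..j}. infinite_in_limit (Q r)"
    and expansion: "cantor_expansion (Q 1) x E"
    and small: "\<exists>\<^sub>\<infinity>n. E n < Min ((\<lambda>r. Q r n - 1) ` {2..j})"
  shows "(x \<in> U_set (Q 1) \<longrightarrow> Psi Q j x \<in> U_set (Q j)) \<and>
    (\<forall>B :: nat list.
      (\<lambda>n. real (block_count M (Q j) n B (Psi Q j x)) - real (block_count M (Q 1) n B x))
        \<in> O(\<lambda>n. 1))"
proof -
  have small': "\<exists>\<^sub>\<infinity>n. \<forall>r\<in>{2..j}. E n < Q r n - 1"
    using small by (rule INFM_mono) (use j_ge in auto)
  obtain F where F: "cantor_expansion (Q j) (Psi Q j x) F"
    and F_eq: "\<And>n. n \<ge> 1 \<Longrightarrow> F n = Min (insert (E n) ((\<lambda>r. Q r n - 1) ` {2..j}))"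
    using Psi_expansion[OF _ Q_basic expansion small'] j_ge by auto
  have basic: "basic_sequence (Q 1)" "basic_sequence (Q j)"
    using Q_basic j_ge by auto
  \<comment> \<open>A minimum can take a value below all clipping bounds only through
    \<open>E n\<close>. This serves both claims: c = 0 for membership, c an entry of B for
    counting.\<close>
  have F_iff: "F n = c \<longleftrightarrow> E n = c" if "n \<ge> 1" "\<forall>r\<in>{2..j}. c < Q r n - 1" for n c
    using j_ge that by (auto simp: F_eq Min_eq_iff Min_insert min_def)
  have "Psi Q j x \<in> U_set (Q j)" if "x \<in> U_set (Q 1)"
  proof -
    from that obtain E' where E': "cantor_expansion (Q 1) x E'" "\<exists>\<^sub>\<infinity>n. E' n \<noteq> 0"
      by (auto simp: U_set_def)
    have E'_eq: "E' = E"
      using cantor_digit_eq[OF basic(1)] E'(1) expansion by metis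
    have "F n \<noteq> 0 \<longleftrightarrow> E n \<noteq> 0" if "n \<ge> 1" for n
    proof -
      have "0 < Q r n - 1" if "r \<in> {2..j}" for r
      proof -
        have "basic_sequence (Q r)" using Q_basic that by auto
        then have "2 \<le> Q r n" using \<open>n \<ge> 1\<close> by (simp add: basic_sequence_def)
        then show ?thesis by simp
      qed
      then show ?thesis using F_iff that by blast
    qed
    then have "\<forall>\<^sub>\<infinity>n. E n \<noteq> 0 \<longrightarrow> F n \<noteq> 0"
      unfolding MOST_nat_le by blast
    then have "\<exists>\<^sub>\<infinity>n. F n \<noteq> 0"
      using E'(2) unfolding E'_eq by (rule frequently_mp)
    then show ?thesis using F by (auto simp: U_set_def)
  qed
  moreover have "(\<lambda>n. real (block_count M (Q j) n B (Psi Q j x)) - real (block_count M (Q 1) n B x))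
      \<in> O(\<lambda>n. 1)" for B :: "nat list"
  proof -
    \<comment> \<open>\<open>sum_list B\<close> bounds every entry of B, also when B is empty;
      adding 2 puts each entry strictly below \<open>Q r n - 1\<close>.\<close>
    obtain N where N: "\<And>n r. n \<ge> N \<Longrightarrow> r \<in> {1..j} \<Longrightarrow> int (sum_list B) + 2 \<le> Q r n"
      using eventually_ge_all[OF finite_atLeastAtMost Q_inf, of "int (sum_list B) + 2"]
      unfolding eventually_sequentially by blast
    \<comment> \<open>\<open>Suc N\<close> instead of N keeps n at least 1, as \<open>F_iff\<close>
      demands.\<close>
    have "F n = int b \<longleftrightarrow> E n = int b" if "n \<ge> Suc N" "b \<in> set B" for n b
    proof (rule F_iff)
      show "\<forall>r\<in>{2..j}. int b < Q r n - 1"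
      proof
        fix r assume "r \<in> {2..j}"
        then have "int (sum_list B) + 2 \<le> Q r n" using that(1) by (intro N) auto
        moreover have "b \<le> sum_list B" using that(2) by (simp add: member_le_sum_list)
        ultimately show "int b < Q r n - 1" by linarith
      qed
    qed (use that in simp)
    \<comment> \<open>The bound is the number of starts up to \<open>Suc N\<close>, which is
      independent of n and so serves as the O(1) constant.\<close>
    note bound = block_count_diff_le[OF M_pos M_incr basic(1) expansion basic(2) F this]
    show ?thesis
      by (rule bigoI[where c = "real (card {t. t \<ge> 1 \<and> M t \<le> Suc N})"]) (use bound in simp)
  qed
  ultimately show ?thesis by blast
qed

end
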